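(* Let $I \subseteq \mathbb{R}$ be an interval with interior $I^{\circ}$, let $f: I \to \mathbb{R}$ be three times differentiable on $I^{\circ}$, let $a,b \in I^{\circ}$ with $a<b$, and suppose $f''' \in L[a,b]$. If $|f'''|$ is quasi-convex on $[a,b]$, then $$\left| f\left(\frac{a+b}{2}\right) - \frac{1}{b-a}\int_a^b f(x)\,dx + \frac{b-a}{24}\,[f'(b)-f'(a)] \right| \le \frac{(b-a)^3}{192}\max\{|f'''(a)|,|f'''(b)|\}.$$
   Context: A function $g:[a,b]\to\mathbb{R}$ is called quasi-convex on $[a,b]$ if $g(\lambda x+(1-\lambda)y)\le \max\{g(x),g(y)\}$ for all $x,y\in[a,b]$ and all $\lambda\in[0,1]$. $L[a,b]$ denotes the Lebesgue integrable functions on $[a,b]$. *)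

theory Defs
  imports "HOL-Analysis.Analysis"
begin

definition quasi_convex_on :: "real set \<Rightarrow> (real \<Rightarrow> real) \<Rightarrow> bool" where
  "quasi_convex_on S g \<longleftrightarrow> convex S \<and>
     (\<forall>x\<in>S. \<forall>y\<in>S. \<forall>t\<in>{0..1}. g (t * x + (1 - t) * y) \<le> max (g x) (g y))"

text \<open>The derivatives are two-sided, so the notion is meant for points in the interior of the domain
  of f.\<close>

definition times_differentiable_on :: "nat \<Rightarrow> (real \<Rightarrow> real) \<Rightarrow> real set \<Rightarrow> bool" where
  "times_differentiable_on n f S \<longleftrightarrow>
     (\<forall>k<n. \<forall>x\<in>S. ((deriv ^^ k) f) field_differentiable (at x))"

end

theory Submission
  imports Defs
begin

text \<open>With \<open>c\<close> the midpoint, \<open>h = (b - a) / 2\<close> and \<open>F\<close> an antiderivative of \<open>f\<close>, the left-hand side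
  times \<open>b - a\<close> is \<open>\<Phi> h\<close>, where
  \<open>\<Phi> t = 2 * t * f c - (F (c + t) - F (c - t)) + 1/6 * t\<^sup>2 * (f' (c + t) - f' (c - t))\<close>.
  Here \<open>\<Phi> 0 = \<Phi>' 0 = 0\<close>, and \<open>\<Phi>'' t = G t + 1/6 * t\<^sup>2 * (f''' (c + t) - f''' (c - t))\<close> with \<open>G 0 = 0\<close>
  and \<open>G' t = 2 / 3 * t * (f''' (c + t) - f''' (c - t))\<close>. Quasi-convexity bounds \<open>\<bar>f'''\<bar>\<close> by its
  larger endpoint value \<open>M\<close>, and three applications of the mean value inequality give
  \<open>\<bar>\<Phi> h\<bar> \<le> M * h ^ 4 / 12\<close>.\<close>

text \<open>The mean value inequality with comparison function \<open>K * s ^ Suc n\<close>, whose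
  derivative is exactly the assumed bound. The factor \<open>real (Suc n)\<close> in that bound
  keeps the conclusion free of division when the lemma is iterated.\<close>

lemma abs_le_power_if_deriv_le:
  fixes g g' :: "real \<Rightarrow> real"
  assumes der: "\<And>t. t \<in> {0..h} \<Longrightarrow> (g has_real_derivative g' t) (at t within {0..h})"
    and bound: "\<And>t. t \<in> {0..h} \<Longrightarrow> \<bar>g' t\<bar> \<le> K * (real (Suc n) * t ^ n)"
    and "g 0 = 0" and t: "t \<in> {0..h}"
  shows "\<bar>g t\<bar> \<le> K * t ^ Suc n"
proof (cases "t = 0")
  case True
  then show ?thesis using \<open>g 0 = 0\<close> by simp
next
  case False
  have "norm (g t - g 0) \<le> K * t ^ Suc n - K * 0 ^ Suc n"
  proof (rule differentiable_bound_general[where f' = g' and \<phi>' = "\<lambda>s. K * (real (Suc n) * s ^ n)"])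
    show "0 < t" using t False by auto
    have "continuous_on {0..h} g"
      by (rule DERIV_continuous_on[OF der])
    then show "continuous_on {0..t} g"
      by (rule continuous_on_subset) (use t in auto)
    show "continuous_on {0..t} (\<lambda>s. K * s ^ Suc n)"
      by (intro continuous_intros)
  next
    fix s assume s: "0 < s" "s < t"
    have "(g has_real_derivative g' s) (at s within {0..h})"
      using der s t by auto
    moreover have "at s within {0..h} = at s"
      using s t by (intro at_within_interior) auto
    ultimately show "(g has_vector_derivative g' s) (at s)"
      by (simp add: has_real_derivative_iff_has_vector_derivative)
    have "((\<lambda>s. K * s ^ Suc n) has_real_derivative K * (real (Suc n) * s ^ n)) (at s)"
      using DERIV_cmult[OF DERIV_pow[of "Suc n" s], of K] by simp
    then show "((\<lambda>s. K * s ^ Suc n) has_vector_derivative K * (real (Suc n) * s ^ n)) (at s)"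
      by (simp only: has_real_derivative_iff_has_vector_derivative)
    show "norm (g' s) \<le> K * (real (Suc n) * s ^ n)"
      using bound[of s] s t by simp
  qed
  then show ?thesis using \<open>g 0 = 0\<close> by simp
qed

lemma has_real_derivative_affine_within:
  fixes g g' :: "real \<Rightarrow> real"
  assumes "\<And>x. x \<in> S \<Longrightarrow> (g has_real_derivative g' x) (at x within S)"
    and "(\<lambda>t. c + m * t) ` T \<subseteq> S" and "t \<in> T"
  shows "((\<lambda>t. g (c + m * t)) has_real_derivative m * g' (c + m * t)) (at t within T)"
proof -
  have "(g has_real_derivative g' (c + m * t)) (at (c + m * t) within (\<lambda>t. c + m * t) ` T)"
    using assms by (intro has_field_derivative_subset[OF assms(1)]) auto
  moreover have "((\<lambda>t. c + m * t) has_real_derivative m) (at t within T)"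
    by (auto intro!: derivative_eq_intros)
  ultimately have "(g \<circ> (\<lambda>t. c + m * t) has_real_derivative g' (c + m * t) * m) (at t within T)"
    by (rule DERIV_image_chain)
  then show ?thesis by (simp add: o_def mult.commute)
qed

text \<open>Derivatives are taken within the closed interval because \<open>F\<close> will be an
  indefinite integral starting at the left endpoint, where only its one-sided derivative is
  controlled.\<close>

lemma midpoint_corrected_bound:
  fixes F f f' f'' f''' :: "real \<Rightarrow> real"
  assumes "0 \<le> h"
    and F: "\<And>x. x \<in> {c - h..c + h} \<Longrightarrow> (F has_real_derivative f x) (at x within {c - h..c + h})"
    and f: "\<And>x. x \<in> {c - h..c + h} \<Longrightarrow> (f has_real_derivative f' x) (at x within {c - h..c + h})"
    and f': "\<And>x. x \<in> {c - h..c + h} \<Longrightarrow> (f' has_real_derivative f'' x) (at x within {c - h..c + h})"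
    and f'': "\<And>x. x \<in> {c - h..c + h} \<Longrightarrow> (f'' has_real_derivative f''' x) (at x within {c - h..c + h})"
    and M: "\<And>x. x \<in> {c - h..c + h} \<Longrightarrow> \<bar>f''' x\<bar> \<le> M"
  shows "\<bar>2 * h * f c - (F (c + h) - F (c - h)) + 1/6 * h\<^sup>2 * (f' (c + h) - f' (c - h))\<bar>
    \<le> M / 12 * h ^ 4"
proof -
  have plus: "((\<lambda>t. g (c + t)) has_real_derivative g' (c + t)) (at t within {0..h})"
    and minus: "((\<lambda>t. g (c - t)) has_real_derivative - g' (c - t)) (at t within {0..h})"
    if "\<And>x. x \<in> {c - h..c + h} \<Longrightarrow> (g has_real_derivative g' x) (at x within {c - h..c + h})"
      and "t \<in> {0..h}" for g g' t
  proof -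
    have sub: "(\<lambda>t. c + 1 * t) ` {0..h} \<subseteq> {c - h..c + h}" "(\<lambda>t. c + (-1) * t) ` {0..h} \<subseteq> {c - h..c + h}"
      by auto
    show "((\<lambda>t. g (c + t)) has_real_derivative g' (c + t)) (at t within {0..h})"
      using has_real_derivative_affine_within[OF that(1) sub(1) that(2)] by simp
    show "((\<lambda>t. g (c - t)) has_real_derivative - g' (c - t)) (at t within {0..h})"
      using has_real_derivative_affine_within[OF that(1) sub(2) that(2)] by simp
  qed
  note der = plus[OF F] minus[OF F] plus[OF f] minus[OF f] plus[OF f'] minus[OF f']
    plus[OF f''] minus[OF f'']
  have M': "\<bar>f''' (c + t) - f''' (c - t)\<bar> \<le> 2 * M" if "t \<in> {0..h}" for t
    using M[of "c + t"] M[of "c - t"] that by auto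
  \<comment> \<open>\<open>P2\<close> is the derivative of \<open>P1\<close>, and \<open>P1\<close>
    that of \<open>P\<close>. As \<open>f'''\<close> is only bounded, \<open>P2\<close> is not
    differentiated again; \<open>G\<close> is its part without \<open>f'''\<close>, which can
    be.\<close>
  define G where "G t = 2/3 * (t * (f'' (c + t) + f'' (c - t)) - (f' (c + t) - f' (c - t)))" for t
  define P2 where "P2 t = G t + 1/6 * t\<^sup>2 * (f''' (c + t) - f''' (c - t))" for t
  define P1 where "P1 t = 2 * f c - f (c + t) - f (c - t) + 1/3 * t * (f' (c + t) - f' (c - t))
    + 1/6 * t\<^sup>2 * (f'' (c + t) + f'' (c - t))" for t
  define P where "P t = 2 * t * f c - (F (c + t) - F (c - t)) + 1/6 * t\<^sup>2 * (f' (c + t) - f' (c - t))" for t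
  have G: "\<bar>G t\<bar> \<le> 2/3 * M * t ^ Suc 1" if "t \<in> {0..h}" for t
  proof (rule abs_le_power_if_deriv_le[OF _ _ _ that])
    fix t assume t: "t \<in> {0..h}"
    \<comment> \<open>The product rule yields \<open>f'' (c + t) + f'' (c - t)\<close>, which
      cancels against the derivative of \<open>f' (c + t) - f' (c - t)\<close>.\<close>
    show "(G has_real_derivative 2/3 * t * (f''' (c + t) - f''' (c - t))) (at t within {0..h})"
      unfolding G_def
      by (rule DERIV_cong, (assumption | rule der[OF _ t] derivative_intros)+) (simp add: algebra_simps)
    have "\<bar>2/3 * t * (f''' (c + t) - f''' (c - t))\<bar> \<le> 2/3 * t * (2 * M)"
      using M'[OF t] t unfolding abs_mult by (intro mult_mono) auto
    then show "\<bar>2/3 * t * (f''' (c + t) - f''' (c - t))\<bar> \<le> 2/3 * M * (real (Suc 1) * t ^ 1)"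
      by (simp add: algebra_simps)
  qed (simp add: G_def)
  have P1: "\<bar>P1 t\<bar> \<le> M / 3 * t ^ Suc 2" if "t \<in> {0..h}" for t
  proof (rule abs_le_power_if_deriv_le[OF _ _ _ that])
    fix t assume t: "t \<in> {0..h}"
    show "(P1 has_real_derivative P2 t) (at t within {0..h})"
      unfolding P1_def P2_def G_def
      by (rule DERIV_cong, (assumption | rule der[OF _ t] derivative_intros)+) (simp add: field_simps power2_eq_square)
    \<comment> \<open>The two parts of \<open>P2\<close> contribute
      \<open>2/3 * M * t\<^sup>2\<close> and \<open>1/3 * M * t\<^sup>2\<close>, in total
      \<open>M * t\<^sup>2\<close>.\<close>
    have "\<bar>1/6 * t\<^sup>2 * (f''' (c + t) - f''' (c - t))\<bar> \<le> t\<^sup>2 / 6 * (2 * M)"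
      using M'[OF t] t unfolding abs_mult by (intro mult_mono) auto
    then have "\<bar>P2 t\<bar> \<le> 2/3 * M * t ^ Suc 1 + t\<^sup>2 / 6 * (2 * M)"
      unfolding P2_def using G[OF t] by linarith
    then show "\<bar>P2 t\<bar> \<le> M / 3 * (real (Suc 2) * t ^ 2)"
      by (simp add: power2_eq_square algebra_simps)
  qed (simp add: P1_def)
  have "\<bar>P h\<bar> \<le> M / 12 * h ^ Suc 3"
  proof (rule abs_le_power_if_deriv_le[where h = h])
    fix t assume t: "t \<in> {0..h}"
    show "(P has_real_derivative P1 t) (at t within {0..h})"
      unfolding P_def P1_def
      by (rule DERIV_cong, (assumption | rule der[OF _ t] derivative_intros)+) (simp add: field_simps power2_eq_square)
    show "\<bar>P1 t\<bar> \<le> M / 12 * (real (Suc 3) * t ^ 3)"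
      using P1[OF t] by (simp add: eval_nat_numeral)
  qed (use \<open>0 \<le> h\<close> in \<open>auto simp: P_def\<close>)
  then show ?thesis by (simp add: P_def eval_nat_numeral)
qed

text \<open>Every point of the interval is a convex combination of the endpoints. For
  \<open>\<bar>f'''\<bar>\<close> this supplies the uniform bound \<open>M\<close>.\<close>

lemma quasi_convex_on_le_endpoints:
  assumes "quasi_convex_on {a..b} g" and "x \<in> {a..b}"
  shows "g x \<le> max (g a) (g b)"
proof -
  have "x \<in> closed_segment a b"
    using assms(2) by (simp add: closed_segment_eq_real_ivl)
  then obtain u where "0 \<le> u" "u \<le> 1" "x = (1 - u) * a + u * b"
    by (auto simp: closed_segment_def)
  moreover have "g (u * b + (1 - u) * a) \<le> max (g b) (g a)"
    if "0 \<le> u" "u \<le> 1" for u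
    using assms that unfolding quasi_convex_on_def by auto
  ultimately show ?thesis by (metis add.commute max.commute)
qed

theorem theorem2p6:
  fixes I :: "real set" and f :: "real \<Rightarrow> real" and a b :: real
  assumes "is_interval I"
    and "times_differentiable_on 3 f (interior I)"
    and "a \<in> interior I" and "b \<in> interior I" and "a < b"
    and "set_integrable lebesgue {a..b} ((deriv ^^ 3) f)"
    and "quasi_convex_on {a..b} (\<lambda>x. \<bar>(deriv ^^ 3) f x\<bar>)"
  shows "\<bar>f ((a + b) / 2) - (1 / (b - a)) * (LINT x:{a..b}|lebesgue. f x)
            + (b - a) / 24 * (deriv f b - deriv f a)\<bar>
         \<le> (b - a) ^ 3 / 192 * max \<bar>(deriv ^^ 3) f a\<bar> \<bar>(deriv ^^ 3) f b\<bar>"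
proof -
  define M where "M = max \<bar>(deriv ^^ 3) f a\<bar> \<bar>(deriv ^^ 3) f b\<bar>"
  define c where "c = (a + b) / 2"
  define h where "h = (b - a) / 2"
  have ab: "a = c - h" "b = c + h" and "0 < h"
    using \<open>a < b\<close> by (simp_all add: c_def h_def field_simps)
  \<comment> \<open>Convexity puts the whole segment between \<open>a\<close> and \<open>b\<close>
    inside \<open>interior I\<close>, where the derivatives exist.\<close>
  have "convex (interior I)"
    using \<open>is_interval I\<close> by (simp add: is_interval_convex convex_interior)
  then have "{a..b} \<subseteq> interior I"
    using closed_segment_subset[of a "interior I" b] assms(3-5)
    by (simp add: closed_segment_eq_real_ivl)
  then have der: "((deriv ^^ k) f has_real_derivative (deriv ^^ Suc k) f x) (at x within {a..b})"
    if "x \<in> {a..b}" "k < 3" for x k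
  proof -
    have "(deriv ^^ k) f field_differentiable at x"
      using assms(2) that \<open>{a..b} \<subseteq> interior I\<close> unfolding times_differentiable_on_def by blast
    then have "((deriv ^^ k) f has_real_derivative (deriv ^^ Suc k) f x) (at x)"
      by (simp add: field_differentiable_derivI)
    then show ?thesis
      by (rule has_field_derivative_at_within)
  qed
  define F where "F x = integral {a..x} f" for x
  have cont: "continuous_on {a..b} f"
    using der[of _ 0] by (intro DERIV_continuous_on[of _ f "deriv f"]) simp
  have F: "(F has_real_derivative f x) (at x within {a..b})" if "x \<in> {a..b}" for x
    unfolding F_def using integral_has_real_derivative[OF cont that] .
  \<comment> \<open>Continuity of \<open>f\<close> makes the Lebesgue and the gauge integral agree;
    \<open>F a\<close> is an integral over a single point, hence 0.\<close>
  have Fb: "(LINT x:{a..b}|lebesgue. f x) = F b - F a"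
    using set_lebesgue_integral_eq_integral(2)[OF absolutely_integrable_continuous_real[OF cont]]
    by (simp add: F_def)
  have "\<bar>2 * h * f c - (F b - F a) + 1/6 * h\<^sup>2 * (deriv f b - deriv f a)\<bar> \<le> M / 12 * h ^ 4"
    unfolding ab
  proof (rule midpoint_corrected_bound[where f = f and f'' = "(deriv ^^ 2) f" and f''' = "(deriv ^^ 3) f"],
      fold ab)
    fix x assume x: "x \<in> {a..b}"
    show "(F has_real_derivative f x) (at x within {a..b})" by (rule F[OF x])
    show "(f has_real_derivative deriv f x) (at x within {a..b})" using der[OF x, of 0] by simp
    show "(deriv f has_real_derivative (deriv ^^ 2) f x) (at x within {a..b})"
      using der[OF x, of 1] by (simp add: eval_nat_numeral)
    show "((deriv ^^ 2) f has_real_derivative (deriv ^^ 3) f x) (at x within {a..b})"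
      using der[OF x, of 2] by (simp add: eval_nat_numeral)
    show "\<bar>(deriv ^^ 3) f x\<bar> \<le> M"
      using quasi_convex_on_le_endpoints[OF assms(7) x] by (simp add: M_def)
  qed (use \<open>0 < h\<close> in simp)
  \<comment> \<open>Factoring out \<open>2 * h = b - a\<close> recovers the stated expression, since
    \<open>h\<^sup>2 / 6 = 2 * h * (2 * h / 24)\<close>.\<close>
  moreover have "2 * h * f c - (F b - F a) + 1/6 * h\<^sup>2 * (deriv f b - deriv f a)
    = 2 * h * (f c - 1 / (2 * h) * (F b - F a) + 2 * h / 24 * (deriv f b - deriv f a))" (is "_ = 2 * h * ?E")
    using \<open>0 < h\<close> by (simp add: field_simps power2_eq_square)
  ultimately have "2 * h * \<bar>?E\<bar> \<le> M / 12 * h ^ 4"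
    using \<open>0 < h\<close> by (simp add: abs_mult)
  \<comment> \<open>The constant 192 arises from
    \<open>h ^ 4 / 12 = 2 * h * ((2 * h) ^ 3 / 192)\<close>.\<close>
  then have "2 * h * \<bar>?E\<bar> \<le> 2 * h * ((2 * h) ^ 3 / 192 * M)"
    by (simp add: eval_nat_numeral algebra_simps)
  then have "\<bar>?E\<bar> \<le> (2 * h) ^ 3 / 192 * M"
    using \<open>0 < h\<close> by (simp only: mult_le_cancel_left_pos)
  moreover have "2 * h = b - a" by (simp add: h_def)
  ultimately show ?thesis
    unfolding Fb M_def c_def by simp
qed

end
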